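(* Let $f:\mathbb{R}^n\to\mathbb{R}$ be convex and differentiable with $L$-Lipschitz continuous gradient ($L>0$), let $s\in\mathbb{N}$, assume $f$ is bounded below on $A_s=\{w\in\mathbb{R}^n:\|w\|_0\le s\}$, and let $\lambda\in(0,L^{-1})$. Let $\{w^k\}$ be generated by the projected gradient iteration $w^{k+1}\in T^\lambda_{\mathrm{PG}}(w^k):=P_{A_s}(w^k-\lambda\nabla f(w^k))$, and let $w^*\in A_s$ be such that either $w^k\to w^*$, or $w^*$ is an accumulation point of $\{w^k\}$ for which $T^\lambda_{\mathrm{PG}}(w^* )$ is a singleton (in the latter case it is known that also $w^k\to w^*$). Let $N\in\mathbb{N}$ be such that $\{w^k\}_{k=N}^\infty\subseteq\bigcup_{J\in\mathcal{I}_{w^*}}A_J$ (such $N$ is known to exist). Assume that $f$ is twice-differentiable around a neighborhood $U$ of $w^*$, with $\nabla^2f_J$ Lipschitz continuous in $U$ and $\nabla^2f_J(w^* )$ positive definite for all $J\in\mathcal{I}_{w^*}$. Suppose that, starting after $k\ge N$ and $P_{A_s}(w^k)\subset U$, we conduct $t$ Newton steps between every two projected gradient steps, for $t\ge1$: $$w^{k,0}\in P_{A_s}(w^k),\qquad J\in\mathcal{I}_{w^{k,0}},$$ $$w^{k,j+1}_i=0\ \ \forall i\notin J,\qquad w^{k,j+1}_J=w^{k,j}_J-\nabla^2f_J(w^{k,j}_J)^{-1}\nabla f_J(w^{k,j}_J),\qquad j=0,\dots,t-1,$$ $$w^{k+1}\in T^\lambda_{\mathrm{PG}}(w^{k,t}).$$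 Then $w^k\to w^*$ at a $Q$-quadratic rate.
   Context: $\|w\|_0$ is the number of nonzero components of $w\in\mathbb{R}^n$; $\|\cdot\|$ is the Euclidean norm. $P_{A_s}(z)$ is the (possibly set-valued) projection, i.e. the set of points of $A_s$ nearest to $z$ in Euclidean distance. $\mathcal{J}_s:=\{J\subseteq\{1,\dots,n\}:|J|=s\}$, $A_J:=\mathrm{span}\{e_j:j\in J\}$ with $e_j$ the $j$th standard unit vector, and for $w\in A_s$, $\mathcal{I}_w:=\{J\in\mathcal{J}_s:w\in A_J\}$. For $v\in\mathbb{R}^n$, $v_J$ is the subvector of coordinates indexed by $J$. For $J\in\mathcal{J}_s$ and $w\in A_J$, $f_J(w_J):=f(w)$; i.e. $f_J$ is $f$ regarded as a function of the coordinates in $J$ only, with the remaining coordinates treated as constant zeros; $\nabla^2 f_J(w^* )$ means $\nabla^2f_J$ evaluated at $w^*_J$, and "$\nabla^2f_J$ Lipschitz continuous in $U$" means Lipschitz continuous on $\{w_J:w\in A_J\cap U\}$. $Q$-quadratic rate: there is $C>0$ such that $\|w^{k+1}-w^*\|\le C\|w^k-w^*\|^2$ for all sufficiently large $k$.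
   Formalization: Proved for P_{A_s}(w^k) in some neighborhood V of w* inside U rather than in U itself; and if T_PG(w* ) is not a singleton, the inclusion of w^k, k ≥ N, in the union of A_J, J in I_{w*}, is also assumed of the iterates with Newton steps. Without these the claim fails. *)

theory Defs
  imports "HOL-Analysis.Analysis"
begin

definition l0_norm :: "real ^ 'n \<Rightarrow> nat" where
  "l0_norm w = card {i. w $ i \<noteq> 0}"

definition sparse_set :: "nat \<Rightarrow> (real ^ 'n) set" where
  "sparse_set s = {w. l0_norm w \<le> s}"

definition proj_set :: "'a::metric_space set \<Rightarrow> 'a \<Rightarrow> 'a set" where
  "proj_set A z = {x \<in> A. \<forall>y\<in>A. dist z x \<le> dist z y}"

definition coord_subspace :: "'n set \<Rightarrow> (real ^ 'n) set" where
  "coord_subspace J = span ((\<lambda>j. axis j 1) ` J)"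

definition index_sets :: "nat \<Rightarrow> real ^ 'n \<Rightarrow> 'n set set" where
  "index_sets s w = {J. card J = s \<and> w \<in> coord_subspace J}"

text \<open>Meaningful at points of differentiability.\<close>

definition gradient :: "('a::real_inner \<Rightarrow> real) \<Rightarrow> 'a \<Rightarrow> 'a" where
  "gradient f x = (THE D. GDERIV f x :> D)"

definition hessian :: "(real ^ 'n \<Rightarrow> real) \<Rightarrow> real ^ 'n \<Rightarrow> real ^ 'n ^ 'n" where
  "hessian f x = jacobian (gradient f) (at x)"

definition PG_map :: "nat \<Rightarrow> real \<Rightarrow> (real ^ 'n \<Rightarrow> real) \<Rightarrow> real ^ 'n \<Rightarrow> (real ^ 'n) set" where
  "PG_map s lam f w = proj_set (sparse_set s) (w - lam *\<^sub>R gradient f w)"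

text \<open>
  The space of vectors indexed by a set \<open>J\<close> of coordinates is identified with
  \<open>coord_subspace J\<close>: the subvector of \<open>v\<close> is stored in the entries in \<open>J\<close>, padded with zeros.
  Accordingly \<open>sub_fun f J\<close> is a function on the whole space which depends only on the coordinates
  in \<open>J\<close>. Its gradient is supported on \<open>J\<close> and its Hessian on the \<open>J\<close> times \<open>J\<close> block, and
  inversion of that block is inversion of the linear map on \<open>coord_subspace J\<close>.
\<close>

definition subvec :: "'n set \<Rightarrow> real ^ 'n \<Rightarrow> real ^ 'n" where
  "subvec J v = (\<chi> i. if i \<in> J then v $ i else 0)"

definition sub_fun :: "(real ^ 'n \<Rightarrow> real) \<Rightarrow> 'n set \<Rightarrow> real ^ 'n \<Rightarrow> real" where
  "sub_fun f J x = f (subvec J x)"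

definition pos_def_on :: "'n set \<Rightarrow> real ^ 'n ^ 'n \<Rightarrow> bool" where
  "pos_def_on J H \<longleftrightarrow> (\<forall>x \<in> coord_subspace J. x \<noteq> 0 \<longrightarrow> x \<bullet> (H *v x) > 0)"

definition inverse_on :: "'n set \<Rightarrow> real ^ 'n ^ 'n \<Rightarrow> real ^ 'n \<Rightarrow> real ^ 'n" where
  "inverse_on J H = the_inv_into (coord_subspace J) ((*v) H)"

text \<open>\<open>newton_step f J y y'\<close>: the point \<open>y'\<close> is the Newton update of \<open>y\<close> restricted to \<open>J\<close>.\<close>

definition newton_step :: "(real ^ 'n \<Rightarrow> real) \<Rightarrow> 'n set \<Rightarrow> real ^ 'n \<Rightarrow> real ^ 'n \<Rightarrow> bool" where
  "newton_step f J y y' \<longleftrightarrow>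
     (\<forall>i. i \<notin> J \<longrightarrow> y' $ i = 0) \<and>
     subvec J y' = subvec J y
       - inverse_on J (hessian (sub_fun f J) (subvec J y)) (gradient (sub_fun f J) (subvec J y))"

text \<open>One outer iteration, from \<open>w\<close> to \<open>w'\<close>: \<open>t\<close> Newton steps on one common \<open>J\<close>, then one
  projected gradient step.\<close>

definition newton_PG_step ::
    "nat \<Rightarrow> real \<Rightarrow> (real ^ 'n \<Rightarrow> real) \<Rightarrow> nat \<Rightarrow> real ^ 'n \<Rightarrow> real ^ 'n \<Rightarrow> bool" where
  "newton_PG_step s lam f t w w' \<longleftrightarrow>
     (\<exists>y J. y 0 \<in> proj_set (sparse_set s) w \<and> J \<in> index_sets s (y 0) \<and>
            (\<forall>j<t. newton_step f J (y j) (y (Suc j))) \<and>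
            w' \<in> PG_map s lam f (y t))"

definition seq_accumulation_point :: "(nat \<Rightarrow> 'a::topological_space) \<Rightarrow> 'a \<Rightarrow> bool" where
  "seq_accumulation_point v x \<longleftrightarrow> (\<exists>r. strict_mono r \<and> (v \<circ> r) \<longlonglongrightarrow> x)"

definition Q_quadratic_rate :: "(nat \<Rightarrow> 'a::real_normed_vector) \<Rightarrow> 'a \<Rightarrow> bool" where
  "Q_quadratic_rate w x \<longleftrightarrow>
     (\<exists>C>0. \<forall>\<^sub>F k in sequentially. norm (w (Suc k) - x) \<le> C * (norm (w k - x))\<^sup>2)"

end

theory Submission
  imports Defs
begin

text \<open>
  The given limit or accumulation point \<open>wstar\<close> is a fixed point of the projected gradient map: a limit
  of the iterates is one because the map has a closed graph, and for an accumulation point the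
  decrease of the objective forces consecutive iterates together
  (\<open>PG_accumulation_point_fixed\<close>).  At a fixed point the gradient vanishes along every coordinate
  subspace \<open>A_J\<close> with \<open>J\<close> in \<open>index_sets s wstar\<close>, so \<open>wstar\<close> is a stationary point of the
  restriction of \<open>f\<close> to each of them.

  A sparse point \<open>x\<close> close to \<open>wstar\<close> is nonzero wherever \<open>wstar\<close> is.  Hence every \<open>J\<close> that
  may be chosen for the Newton steps at \<open>x\<close> belongs to \<open>index_sets s wstar\<close>, and the steps
  are those of the classical Newton method on \<open>A_J\<close>, where the Hessian is Lipschitz and
  positive definite at the stationary point: they square the error
  (\<open>newton_step_locally_quadratic\<close>).  As there are finitely many \<open>J\<close>, constant and radius can be
  chosen uniformly.

  The projected gradient step that follows costs only a constant factor.  Its result lies in some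
  \<open>A_J\<close> with \<open>J\<close> in \<open>index_sets s wstar\<close>, either by hypothesis or, if the map is single-valued at
  \<open>wstar\<close>, because its values near \<open>wstar\<close> stay near \<open>wstar\<close> (\<open>PG_map_near_singleton\<close>).  On
  such a result the projection acts as the linear projection onto \<open>A_J\<close>, which gives the
  factor \<open>1 + lam L\<close> (\<open>PG_map_lipschitz_at_fixed_point\<close>).

  After one outer step the error is therefore at most a fixed constant times the square of the
  previous one.  In a small enough ball around \<open>wstar\<close> it is at least halved, so the iteration
  stays in the ball and converges quadratically; that ball is the neighborhood to be found.
\<close>

section \<open>Coordinate subspaces and sparse vectors\<close>

lemma mem_coord_subspace:
  fixes x :: "real ^ 'n"
  shows "x \<in> coord_subspace J \<longleftrightarrow> (\<forall>i. i \<notin> J \<longrightarrow> x $ i = 0)"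
proof
  have "subspace {x :: real ^ 'n. \<forall>i. i \<notin> J \<longrightarrow> x $ i = 0}"
    by (auto simp: subspace_def)
  moreover have "(\<lambda>j. axis j 1) ` J \<subseteq> {x :: real ^ 'n. \<forall>i. i \<notin> J \<longrightarrow> x $ i = 0}"
    by (auto simp: axis_def)
  ultimately have "coord_subspace J \<subseteq> {x. \<forall>i. i \<notin> J \<longrightarrow> x $ i = 0}"
    unfolding coord_subspace_def by (rule span_minimal[rotated])
  then show "x \<in> coord_subspace J \<Longrightarrow> \<forall>i. i \<notin> J \<longrightarrow> x $ i = 0"
    by auto
next
  assume z: "\<forall>i. i \<notin> J \<longrightarrow> x $ i = 0"
  have "x = (\<Sum>j\<in>UNIV. x $ j *\<^sub>R axis j 1)"
    using basis_expansion[of x] by (simp add: scalar_mult_eq_scaleR)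
  also have "\<dots> = (\<Sum>j\<in>J. x $ j *\<^sub>R axis j 1)"
    using z by (intro sum.mono_neutral_right) auto
  also have "\<dots> \<in> coord_subspace J"
    unfolding coord_subspace_def by (intro span_sum span_scale span_base) auto
  finally show "x \<in> coord_subspace J" .
qed

lemma subspace_coord_subspace: "subspace (coord_subspace J)"
  by (simp add: coord_subspace_def)

lemma linear_subvec: "linear (subvec J)"
  by (rule linearI) (auto simp: subvec_def vec_eq_iff)

lemmas bounded_linear_subvec = linear_conv_bounded_linear[THEN iffD1, OF linear_subvec]

lemma subvec_mem_coord_subspace: "subvec J x \<in> coord_subspace J"
  by (simp add: mem_coord_subspace subvec_def)

lemma subvec_eq_self_iff: "subvec J x = x \<longleftrightarrow> x \<in> coord_subspace J"
  by (auto simp: mem_coord_subspace subvec_def vec_eq_iff)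

lemma inner_subvec_left: "subvec J x \<bullet> y = x \<bullet> subvec J y"
  by (auto simp: inner_vec_def subvec_def intro!: sum.cong)

lemma norm_subvec_le: "norm (subvec J x) \<le> norm x"
  by (rule norm_le_componentwise_cart) (auto simp: subvec_def)

lemma index_sets_coord_subset_sparse:
  assumes "J \<in> index_sets s w"
  shows "coord_subspace J \<subseteq> sparse_set s"
proof
  fix x assume "x \<in> coord_subspace J"
  then have "{i. x $ i \<noteq> 0} \<subseteq> J" by (auto simp: mem_coord_subspace)
  then have "card {i. x $ i \<noteq> 0} \<le> card J" by (intro card_mono) auto
  then show "x \<in> sparse_set s"
    using assms by (simp add: sparse_set_def l0_norm_def index_sets_def)
qed

lemma sparse_index_sets_nonempty:
  fixes w :: "real ^ 'n"
  assumes "w \<in> sparse_set s" "s \<le> CARD('n)"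
  shows "\<exists>J. J \<in> index_sets s w"
proof -
  obtain J where "{i. w $ i \<noteq> 0} \<subseteq> J" "card J = s"
    using exists_subset_between[of "{i. w $ i \<noteq> 0}" s UNIV] assms
    by (auto simp: sparse_set_def l0_norm_def)
  then show ?thesis
    by (auto simp: index_sets_def mem_coord_subspace)
qed

lemma index_sets_antimono:
  assumes "J \<in> index_sets s x" "\<forall>i. w $ i \<noteq> 0 \<longrightarrow> x $ i \<noteq> 0"
  shows "J \<in> index_sets s w"
  using assms by (auto simp: index_sets_def mem_coord_subspace)

lemma nearby_support_superset:
  fixes w :: "real ^ 'n"
  shows "\<exists>r>0. \<forall>x. dist x w < r \<longrightarrow> (\<forall>i. w $ i \<noteq> 0 \<longrightarrow> x $ i \<noteq> 0)"
proof -
  have "\<forall>\<^sub>F x in nhds w. \<forall>i. w $ i \<noteq> 0 \<longrightarrow> x $ i \<noteq> 0"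
  proof (rule eventually_all_finite)
    fix i
    show "\<forall>\<^sub>F x in nhds w. w $ i \<noteq> 0 \<longrightarrow> x $ i \<noteq> 0"
    proof (cases "w $ i = 0")
      case False
      have "((\<lambda>x. x $ i) \<longlongrightarrow> w $ i) (nhds w)"
        by (intro tendsto_vec_nth filterlim_ident)
      then show ?thesis
        using False tendsto_imp_eventually_ne by (metis (mono_tags, lifting) eventually_mono)
    qed simp
  qed
  then show ?thesis by (auto simp: eventually_nhds_metric)
qed

lemma closed_sparse_set: "closed (sparse_set s :: (real ^ 'n) set)"
proof -
  have "sparse_set s = (\<Union>J\<in>{J :: 'n set. card J \<le> s}. coord_subspace J)"
  proof (intro set_eqI iffI)
    fix x :: "real ^ 'n" assume "x \<in> sparse_set s"
    then show "x \<in> (\<Union>J\<in>{J :: 'n set. card J \<le> s}. coord_subspace J)"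
      by (auto simp: sparse_set_def l0_norm_def mem_coord_subspace
          intro!: exI[of _ "{i. x $ i \<noteq> 0}"])
  next
    fix x :: "real ^ 'n" assume "x \<in> (\<Union>J\<in>{J :: 'n set. card J \<le> s}. coord_subspace J)"
    then obtain J where J: "card J \<le> s" "x \<in> coord_subspace J" by auto
    have "card {i. x $ i \<noteq> 0} \<le> card J"
      using J(2) by (intro card_mono) (auto simp: mem_coord_subspace)
    with J(1) show "x \<in> sparse_set s" by (simp add: sparse_set_def l0_norm_def)
  qed
  also have "closed \<dots>"
    by (intro closed_UN) (auto intro: closed_subspace subspace_coord_subspace)
  finally show ?thesis .
qed


section \<open>Set-valued projections\<close>

lemma proj_set_self: "x \<in> A \<Longrightarrow> proj_set A x = {x}"
  by (auto simp: proj_set_def)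

lemma proj_set_closed_graph:
  assumes "closed A" "\<And>n. y n \<in> proj_set A (x n)" "x \<longlonglongrightarrow> a" "y \<longlonglongrightarrow> b"
  shows "b \<in> proj_set A a"
  unfolding proj_set_def
proof (intro CollectI conjI ballI)
  show "b \<in> A"
    using assms closed_sequentially[of A y b] by (auto simp: proj_set_def)
  fix c assume c: "c \<in> A"
  show "dist a b \<le> dist a c"
  proof (rule LIMSEQ_le)
    show "(\<lambda>n. dist (x n) (y n)) \<longlonglongrightarrow> dist a b" "(\<lambda>n. dist (x n) c) \<longlonglongrightarrow> dist a c"
      using assms by (auto intro: tendsto_intros)
    show "\<exists>N. \<forall>n\<ge>N. dist (x n) (y n) \<le> dist (x n) c"
      using assms(2) c by (auto simp: proj_set_def)
  qed
qed

text \<open>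
  Where the nearest point \<open>p\<close> is unique, the points of \<open>A\<close> at distance at least \<open>e\<close> from \<open>p\<close> are
  farther away by a definite gap, as their distance is attained; moving \<open>z\<close> by
  less than half of that gap cannot make any of them nearest.
\<close>

lemma proj_set_upper_semicontinuous:
  fixes z :: "'a::heine_borel"
  assumes A: "closed A" and p: "proj_set A z = {p}" and e: "e > 0"
  shows "\<exists>d>0. \<forall>z'. dist z' z < d \<longrightarrow> proj_set A z' \<subseteq> ball p e"
proof (cases "A \<subseteq> ball p e")
  case True
  then show ?thesis by (auto simp: proj_set_def intro!: exI[of _ 1])
next
  case False
  define B where "B = A - ball p e"
  have "closed B" "B \<noteq> {}" using A False by (auto simp: B_def)
  then obtain b where b: "b \<in> B" "infdist z B = dist z b"
    by (rule infdist_attains_inf)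
  have far: "dist z b \<le> dist z q" if "q \<in> B" for q
    using infdist_le[OF that, of z] b by simp
  have pA: "p \<in> A" "\<forall>y\<in>A. dist z p \<le> dist z y"
    using p by (auto simp: proj_set_def)
  have gap: "dist z p < dist z b"
  proof (rule ccontr)
    assume "\<not> dist z p < dist z b"
    then have "b \<in> proj_set A z" using b pA by (force simp: proj_set_def B_def)
    then have "b = p" using p by simp
    with b e show False by (simp add: B_def)
  qed
  show ?thesis
  proof (intro exI conjI allI impI subsetI)
    show "(dist z b - dist z p) / 2 > 0" using gap by simp
    fix z' q assume z': "dist z' z < (dist z b - dist z p) / 2" and q: "q \<in> proj_set A z'"
    show "q \<in> ball p e"
    proof (rule ccontr)
      assume "q \<notin> ball p e"
      then have "dist z b \<le> dist z q" using q by (intro far) (auto simp: B_def proj_set_def)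
      moreover have "dist z q \<le> dist z' z + dist z' q" by (metis dist_commute dist_triangle)
      moreover have "dist z' q \<le> dist z' p" using q pA by (auto simp: proj_set_def)
      moreover have "dist z' p \<le> dist z' z + dist z p" by (rule dist_triangle)
      ultimately show False using z' by argo
    qed
  qed
qed

text \<open>
  A nearest sparse point that happens to lie in a coordinate subspace contained in the sparse set is
  in particular nearest within that subspace, hence it is the orthogonal projection: the
  combinatorial projection becomes linear once its support is known.
\<close>

lemma proj_sparse_eq_subvec:
  assumes x: "x \<in> proj_set (sparse_set s) z" "x \<in> coord_subspace J" and J: "J \<in> index_sets s w"
  shows "x = subvec J z"
proof -
  have "subvec J z \<in> sparse_set s"
    using index_sets_coord_subset_sparse[OF J] subvec_mem_coord_subspace by blast
  then have "norm (z - x) \<le> norm (z - subvec J z)"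
    using x by (auto simp: proj_set_def dist_norm)
  then have le: "(norm (z - x))\<^sup>2 \<le> (norm (z - subvec J z))\<^sup>2"
    by (simp add: power_mono)
  have s: "subvec J (subvec J z - x) = subvec J z - x"
    unfolding subvec_eq_self_iff
    using subspace_coord_subspace x(2) subvec_mem_coord_subspace by (intro subspace_diff) auto
  have "(z - subvec J z) \<bullet> (subvec J z - x) = (z - subvec J z) \<bullet> subvec J (subvec J z - x)"
    by (simp only: s)
  also have "\<dots> = subvec J (z - subvec J z) \<bullet> (subvec J z - x)"
    by (simp only: inner_subvec_left)
  also have "subvec J (z - subvec J z) = 0"
    by (auto simp: subvec_def vec_eq_iff)
  finally have orth: "(z - subvec J z) \<bullet> (subvec J z - x) = 0" by simp
  have "z - x = (z - subvec J z) + (subvec J z - x)" by simp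
  then have "(norm (z - x))\<^sup>2 = (norm (z - subvec J z))\<^sup>2 + (norm (subvec J z - x))\<^sup>2"
    using orth by (simp only: power2_norm_eq_inner inner_add_left inner_add_right)
      (simp add: inner_commute)
  with le have "norm (subvec J z - x) = 0" by simp
  then show ?thesis by simp
qed


section \<open>Gradients and Hessians along coordinate subspaces\<close>

lemma gderiv_imp_gradient_eq:
  assumes "GDERIV f x :> D"
  shows "gradient f x = D"
  unfolding gradient_def
proof (rule the_equality)
  fix E assume "GDERIV f x :> E"
  then have "(\<lambda>h. h \<bullet> E) = (\<lambda>h. h \<bullet> D)"
    using assms has_derivative_unique unfolding gderiv_def by blast
  then have "E \<bullet> (E - D) = D \<bullet> (E - D)" by (metis inner_commute)
  then have "(E - D) \<bullet> (E - D) = 0" by (simp add: inner_diff_left)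
  then show "E = D" by simp
qed (fact assms)

lemma differentiable_imp_gderiv_gradient:
  fixes f :: "'a::euclidean_space \<Rightarrow> real"
  assumes "f differentiable (at x)"
  shows "GDERIV f x :> gradient f x"
proof -
  obtain f' where f': "(f has_derivative f') (at x)"
    using assms by (auto simp: differentiable_def)
  have "linear f'" using f' by (rule has_derivative_linear)
  then have "f' = (\<lambda>h. h \<bullet> adjoint f' 1)"
    using adjoint_works[of f' _ 1] by (simp add: fun_eq_iff)
  with f' have "GDERIV f x :> adjoint f' 1"
    unfolding gderiv_def by metis
  then show ?thesis using gderiv_imp_gradient_eq by metis
qed

lemma gradient_sub_fun:
  assumes "f differentiable (at (subvec J x))"
  shows "gradient (sub_fun f J) x = subvec J (gradient f (subvec J x))"
proof (rule gderiv_imp_gradient_eq)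
  have "(f has_derivative (\<lambda>h. h \<bullet> gradient f (subvec J x))) (at (subvec J x))"
    using differentiable_imp_gderiv_gradient[OF assms] by (simp add: gderiv_def)
  then have "(f \<circ> subvec J has_derivative (\<lambda>h. h \<bullet> gradient f (subvec J x)) \<circ> subvec J) (at x)"
    by (intro diff_chain_at bounded_linear_imp_has_derivative bounded_linear_subvec)
  then show "GDERIV (sub_fun f J) x :> subvec J (gradient f (subvec J x))"
    by (simp add: gderiv_def sub_fun_def[abs_def] o_def inner_subvec_left)
qed

text \<open>
  That the Hessian of the restriction maps into the subspace makes it an endomorphism there, so that
  injectivity on the subspace will suffice for inverting it.
\<close>

lemma hessian_sub_fun:
  assumes f: "\<forall>x. f differentiable (at x)" and g: "gradient f differentiable (at (subvec J x))"
  shows "(gradient (sub_fun f J) has_derivative (\<lambda>h. hessian (sub_fun f J) x *v h)) (at x)"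
    and "hessian (sub_fun f J) x *v h \<in> coord_subspace J"
proof -
  obtain D where D: "(gradient f has_derivative D) (at (subvec J x))"
    using g by (auto simp: differentiable_def)
  have eq: "gradient (sub_fun f J) = subvec J \<circ> (gradient f \<circ> subvec J)"
    using f gradient_sub_fun by (auto simp: fun_eq_iff)
  have der: "(gradient (sub_fun f J) has_derivative subvec J \<circ> (D \<circ> subvec J)) (at x)"
    unfolding eq
    by (intro diff_chain_at bounded_linear_imp_has_derivative bounded_linear_subvec)
      (use D in simp)
  then have "gradient (sub_fun f J) differentiable (at x)"
    by (auto simp: differentiable_def)
  then show H: "(gradient (sub_fun f J) has_derivative (\<lambda>h. hessian (sub_fun f J) x *v h)) (at x)"
    unfolding hessian_def using jacobian_works by blast
  have "hessian (sub_fun f J) x *v h = subvec J (D (subvec J h))"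
    using has_derivative_unique[OF H der] by (metis comp_apply)
  then show "hessian (sub_fun f J) x *v h \<in> coord_subspace J"
    by (simp add: subvec_mem_coord_subspace)
qed

lemma norm_matrix_vector_mult_le:
  fixes A :: "real ^ 'n ^ 'm"
  shows "norm (A *v x) \<le> norm A * norm x"
proof -
  have "norm (A *v x) = L2_set (\<lambda>i. norm (A $ i \<bullet> x)) UNIV"
    by (simp add: norm_vec_def matrix_vector_mul_component)
  also have "\<dots> \<le> L2_set (\<lambda>i. norm (A $ i) * norm x) UNIV"
    by (intro L2_set_mono) (auto simp: Cauchy_Schwarz_ineq2)
  also have "\<dots> = norm A * norm x"
    by (simp add: norm_vec_def[of A] L2_set_left_distrib)
  finally show ?thesis .
qed

text \<open>
  The quadratic form attains a positive minimum on the unit sphere of the subspace, and is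
  homogeneous of degree two.
\<close>

lemma pos_def_on_coercive:
  assumes "pos_def_on J H"
  shows "\<exists>m>0. \<forall>x\<in>coord_subspace J. m * (norm x)\<^sup>2 \<le> x \<bullet> (H *v x)"
proof -
  define S where "S = sphere 0 1 \<inter> coord_subspace J"
  have "compact S" unfolding S_def
    by (intro compact_Int_closed closed_subspace subspace_coord_subspace compact_sphere)
  have scale: "\<exists>u\<in>S. x = norm x *\<^sub>R u" if "x \<in> coord_subspace J" "x \<noteq> 0" for x
    using that subspace_coord_subspace[of J]
    by (intro bexI[of _ "(1 / norm x) *\<^sub>R x"]) (auto simp: S_def subspace_scale)
  show ?thesis
  proof (cases "S = {}")
    case True
    then have "x = 0" if "x \<in> coord_subspace J" for x using scale that by blast
    then show ?thesis by (intro exI[of _ 1]) force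
  next
    case False
    have "continuous_on S (\<lambda>x. x \<bullet> (H *v x))"
      by (intro continuous_intros linear_continuous_on matrix_vector_mul_bounded_linear)
    then obtain a where a: "a \<in> S" "\<And>x. x \<in> S \<Longrightarrow> a \<bullet> (H *v a) \<le> x \<bullet> (H *v x)"
      using continuous_attains_inf[OF \<open>compact S\<close> False] by blast
    show ?thesis
    proof (intro exI conjI ballI)
      show "a \<bullet> (H *v a) > 0" using assms a(1) by (auto simp: pos_def_on_def S_def)
      fix x assume x: "x \<in> coord_subspace J"
      show "a \<bullet> (H *v a) * (norm x)\<^sup>2 \<le> x \<bullet> (H *v x)"
      proof (cases "x = 0")
        case False
        then obtain u where u: "u \<in> S" "x = norm x *\<^sub>R u" using scale x by blast
        have "x \<bullet> (H *v x) = (norm x)\<^sup>2 * (u \<bullet> (H *v u))"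
          by (subst (1 2) u(2)) (simp add: matrix_vector_mult_scaleR power2_eq_square)
        then show ?thesis
          using mult_right_mono[OF a(2)[OF u(1)], of "(norm x)\<^sup>2"] by (simp add: mult.commute)
      qed simp
    qed
  qed
qed

lemma pos_def_on_inverse_on:
  assumes pd: "pos_def_on J H" and maps: "\<And>h. H *v h \<in> coord_subspace J"
    and g: "g \<in> coord_subspace J"
  shows "inverse_on J H g \<in> coord_subspace J" and "H *v inverse_on J H g = g"
proof -
  let ?A = "coord_subspace J"
  have inj: "inj_on ((*v) H) ?A"
  proof (rule inj_onI)
    fix x y assume "x \<in> ?A" "y \<in> ?A" and eq: "H *v x = H *v y"
    then have "x - y \<in> ?A" using subspace_coord_subspace by (intro subspace_diff)
    moreover have "(x - y) \<bullet> (H *v (x - y)) = 0"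
      using eq by (simp add: matrix_vector_mult_diff_distrib)
    ultimately show "x = y" using pd by (force simp: pos_def_on_def)
  qed
  have "(*v) H ` ?A = ?A"
  proof (rule subspace_dim_equal)
    show "subspace ((*v) H ` ?A)"
      by (intro linear_subspace_image subspace_coord_subspace matrix_vector_mul_linear)
    have "span ?A = ?A" by (simp add: span_eq_iff subspace_coord_subspace)
    with inj have "inj_on ((*v) H) (span ?A)" by (simp only:)
    then show "dim ((*v) H ` ?A) \<ge> dim ?A"
      using dim_image_eq[OF matrix_vector_mul_linear] by (metis order_refl)
  qed (use maps subspace_coord_subspace in auto)
  then have "bij_betw ((*v) H) ?A ?A" using inj by (simp add: bij_betw_def)
  then show "inverse_on J H g \<in> ?A" "H *v inverse_on J H g = g"
    using g unfolding inverse_on_def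
    by (auto simp: bij_betw_def intro!: the_inv_into_into f_the_inv_into_f)
qed


section \<open>Local quadratic convergence of Newton steps on a coordinate subspace\<close>

text \<open>
  With \<open>g\<close> and \<open>H\<close> the gradient and Hessian on the subspace, the Newton equation and
  \<open>g wstar = 0\<close> give \<open>H y (y' - wstar) = g wstar - g y - H y (wstar - y)\<close>, a linearization error,
  which is at most \<open>M (norm (y - wstar))^2\<close> because \<open>H\<close> is \<open>M\<close>-Lipschitz.  Coercivity of \<open>H y\<close>,
  inherited from \<open>H wstar\<close> with half the constant, turns this into a bound on \<open>y' - wstar\<close>.
\<close>

lemma newton_step_locally_quadratic:
  fixes f :: "real ^ 'n \<Rightarrow> real"
  assumes f: "\<forall>x. f differentiable (at x)"
    and U: "wstar \<in> interior U" "\<forall>x\<in>U. gradient f differentiable (at x)"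
    and wstar: "wstar \<in> coord_subspace J" "subvec J (gradient f wstar) = 0"
    and lip: "M-lipschitz_on (subvec J ` (coord_subspace J \<inter> U)) (hessian (sub_fun f J))"
    and pd: "pos_def_on J (hessian (sub_fun f J) (subvec J wstar))"
  shows "\<exists>C>0. \<exists>r>0. \<forall>y y'. y \<in> coord_subspace J \<longrightarrow> dist y wstar < r \<longrightarrow> newton_step f J y y' \<longrightarrow>
           y' \<in> coord_subspace J \<and> norm (y' - wstar) \<le> C * (norm (y - wstar))\<^sup>2"
proof -
  let ?A = "coord_subspace J"
  define g where "g = gradient (sub_fun f J)"
  define H where "H = hessian (sub_fun f J)"
  have sub: "subspace ?A" by (rule subspace_coord_subspace)
  have M: "M \<ge> 0" using lip by (rule lipschitz_on_nonneg)
  obtain \<rho> where \<rho>: "\<rho> > 0" "ball wstar \<rho> \<subseteq> U"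
    using U(1) by (auto simp: mem_interior)
  have self: "subvec J x = x" if "x \<in> ?A" for x using that by (simp add: subvec_eq_self_iff)
  then have "subvec J ` (?A \<inter> U) = ?A \<inter> U" by (auto simp: image_iff)
  then have lipH: "norm (H x - H y) \<le> M * norm (x - y)"
    if "x \<in> ?A \<inter> U" "y \<in> ?A \<inter> U" for x y
    using lipschitz_onD[OF lip, of x y] that by (simp add: H_def dist_norm)
  have derH: "(g has_derivative (\<lambda>h. H x *v h)) (at x)" "H x *v h \<in> ?A" if "x \<in> ?A \<inter> U" for x h
    using that U(2) self hessian_sub_fun[OF f, of J x] by (auto simp: g_def H_def)
  have gA: "g x \<in> ?A" for x
    using f by (simp add: g_def gradient_sub_fun subvec_mem_coord_subspace)
  have g0: "g wstar = 0"
    using f wstar self by (simp add: g_def gradient_sub_fun)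
  have wU: "wstar \<in> ?A \<inter> U" using wstar U(1) interior_subset by blast
  obtain m where m: "m > 0" "\<And>x. x \<in> ?A \<Longrightarrow> m * (norm x)\<^sup>2 \<le> x \<bullet> (H wstar *v x)"
    using pos_def_on_coercive[OF pd] self[OF wstar(1)] by (auto simp: H_def)
  define r where "r = min \<rho> (m / (2 * (M + 1)))"
  define C where "C = 2 * M / m + 1"
  have r: "r > 0" using \<rho> m M by (simp add: r_def)
  have C: "C > 0" using m M by (simp add: C_def add_nonneg_pos)
  have main: "y' \<in> ?A \<and> norm (y' - wstar) \<le> C * (norm (y - wstar))\<^sup>2"
    if y: "y \<in> ?A" "dist y wstar < r" and ns: "newton_step f J y y'" for y y'
  proof -
    have yU: "y \<in> ?A \<inter> U"
      using y \<rho> by (auto simp: r_def dist_commute)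
    have "M * norm (y - wstar) \<le> (M + 1) * r"
      using y(2) M r by (intro mult_mono) (auto simp: dist_norm)
    also have "\<dots> \<le> (M + 1) * (m / (2 * (M + 1)))"
      using M by (intro mult_left_mono) (auto simp: r_def)
    also have "\<dots> = m / 2" using M by (simp add: field_simps)
    finally have small: "M * norm (y - wstar) \<le> m / 2" .
    have coer: "m / 2 * (norm x)\<^sup>2 \<le> x \<bullet> (H y *v x)" if x: "x \<in> ?A" for x
    proof -
      have "\<bar>x \<bullet> ((H y - H wstar) *v x)\<bar> \<le> norm x * norm ((H y - H wstar) *v x)"
        by (rule Cauchy_Schwarz_ineq2)
      also have "\<dots> \<le> norm x * (norm (H y - H wstar) * norm x)"
        by (intro mult_left_mono norm_matrix_vector_mult_le) auto
      also have "\<dots> \<le> norm x * (m / 2 * norm x)"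
        using lipH[OF yU wU] small by (intro mult_left_mono mult_right_mono) auto
      also have "\<dots> = m / 2 * (norm x)\<^sup>2" by (simp add: power2_eq_square)
      finally have "\<bar>x \<bullet> (H y *v x) - x \<bullet> (H wstar *v x)\<bar> \<le> m / 2 * (norm x)\<^sup>2"
        by (simp add: matrix_vector_mult_diff_rdistrib inner_diff_right)
      with m(2)[OF x] show ?thesis by linarith
    qed
    have pdy: "pos_def_on J (H y)" unfolding pos_def_on_def
    proof (intro ballI impI)
      fix x assume "x \<in> ?A" "x \<noteq> 0"
      moreover have "m / 2 * (norm x)\<^sup>2 > 0" using \<open>x \<noteq> 0\<close> m by simp
      ultimately show "x \<bullet> (H y *v x) > 0" using coer by force
    qed
    define u where "u = inverse_on J (H y) (g y)"
    have u: "u \<in> ?A" "H y *v u = g y"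
      using pos_def_on_inverse_on[OF pdy derH(2)[OF yU] gA] by (auto simp: u_def)
    have y'A: "y' \<in> ?A" using ns by (simp add: newton_step_def mem_coord_subspace)
    have y': "y' = y - u"
      using ns y self y'A by (simp add: newton_step_def u_def H_def g_def)
    have lin: "norm (g wstar - g y - H y *v (wstar - y)) \<le> norm (wstar - y) * (M * norm (wstar - y))"
    proof (rule differentiable_bound_linearization[where S = "closed_segment y wstar"
          and f = g and f' = "\<lambda>x. (*v) (H x)" and ?x0.0 = y])
      have seg: "x \<in> ?A \<inter> U" if "x \<in> closed_segment y wstar" for x
      proof -
        have "convex (?A \<inter> ball wstar \<rho>)"
          by (intro convex_Int subspace_imp_convex sub convex_ball)
        then have "closed_segment y wstar \<subseteq> ?A \<inter> ball wstar \<rho>"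
          using y wstar \<rho>(1) by (intro closed_segment_subset) (auto simp: r_def dist_commute)
        then show ?thesis using that \<rho> by auto
      qed
      show "y + t *\<^sub>R (wstar - y) \<in> closed_segment y wstar" if "t \<in> {0..1}" for t
        using that by (auto simp: in_segment algebra_simps intro!: exI[of _ t])
      fix x assume x: "x \<in> closed_segment y wstar"
      show "(g has_derivative (*v) (H x)) (at x within closed_segment y wstar)"
        using derH(1)[OF seg[OF x]] by (rule has_derivative_at_withinI)
      have "norm (x - y) \<le> norm (wstar - y)"
        using segment_bound(1)[OF x] by simp
      then have "norm (H x - H y) \<le> M * norm (wstar - y)"
        using lipH[OF seg[OF x] yU] M by (meson mult_left_mono order_trans)
      then show "onorm ((*v) (H x) - (*v) (H y)) \<le> M * norm (wstar - y)"
        by (intro onorm_le)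
          (auto simp: matrix_vector_mult_diff_rdistrib[symmetric]
            intro!: order_trans[OF norm_matrix_vector_mult_le] mult_right_mono)
    qed simp
    have res: "H y *v (y' - wstar) = g wstar - g y - H y *v (wstar - y)"
      by (simp add: y' g0 u(2) matrix_vector_mult_diff_distrib)
    define e where "e = norm (y' - wstar)"
    have "m / 2 * e\<^sup>2 \<le> (y' - wstar) \<bullet> (H y *v (y' - wstar))"
      unfolding e_def using y'A wstar sub by (intro coer subspace_diff)
    also have "\<dots> \<le> e * norm (H y *v (y' - wstar))"
      unfolding e_def by (rule norm_cauchy_schwarz)
    also have "\<dots> \<le> e * (M * (norm (y - wstar))\<^sup>2)"
      using lin unfolding res
      by (intro mult_left_mono) (auto simp: e_def power2_eq_square norm_minus_commute algebra_simps)
    finally have "e * (m / 2 * e) \<le> e * (M * (norm (y - wstar))\<^sup>2)"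
      by (simp add: power2_eq_square algebra_simps)
    then have "m / 2 * e \<le> M * (norm (y - wstar))\<^sup>2"
      using M by (cases "e = 0") (auto simp: e_def mult_le_cancel_left)
    then have "e \<le> 2 * M / m * (norm (y - wstar))\<^sup>2"
      using m(1) by (simp add: field_simps)
    also have "\<dots> \<le> C * (norm (y - wstar))\<^sup>2"
      unfolding C_def by (intro mult_right_mono) auto
    finally show ?thesis using y'A by (simp add: e_def)
  qed
  then show ?thesis using C r by blast
qed


section \<open>Fixed points of the projected gradient map\<close>

text \<open>
  The map \<open>t \<mapsto> f (x + t d) - t (gradient f x \<bullet> d) - L t^2 (norm d)^2 / 2\<close> has
  nonpositive derivative on the unit interval, by the Cauchy-Schwarz inequality and the Lipschitz
  bound on the gradient.
\<close>

lemma lipschitz_gradient_descent: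
  fixes f :: "'a::euclidean_space \<Rightarrow> real"
  assumes f: "\<forall>x. f differentiable (at x)" and lip: "L-lipschitz_on UNIV (gradient f)"
  shows "f (x + d) \<le> f x + gradient f x \<bullet> d + L / 2 * (norm d)\<^sup>2"
proof -
  define \<phi> where "\<phi> t = f (x + t *\<^sub>R d) - t * (gradient f x \<bullet> d) - L / 2 * t\<^sup>2 * (norm d)\<^sup>2" for t
  have "\<phi> 1 \<le> \<phi> 0"
  proof (rule DERIV_nonpos_imp_nonincreasing[where f = \<phi>])
    fix t :: real assume t: "0 \<le> t" "t \<le> 1"
    have "(f has_derivative (\<lambda>h. h \<bullet> gradient f (x + t *\<^sub>R d))) (at (x + t *\<^sub>R d))"
      using f differentiable_imp_gderiv_gradient unfolding gderiv_def by blast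
    then have "((\<lambda>t. f (x + t *\<^sub>R d)) has_derivative (\<lambda>h. (h *\<^sub>R d) \<bullet> gradient f (x + t *\<^sub>R d))) (at t)"
      by (rule has_derivative_compose[rotated]) (auto intro!: derivative_eq_intros)
    then have "DERIV (\<lambda>t. f (x + t *\<^sub>R d)) t :> d \<bullet> gradient f (x + t *\<^sub>R d)"
      unfolding has_field_derivative_def by (simp add: mult.commute[of _ "d \<bullet> _"] mult_commute_abs)
    then have "DERIV \<phi> t :> d \<bullet> gradient f (x + t *\<^sub>R d) - gradient f x \<bullet> d - L * t * (norm d)\<^sup>2"
      unfolding \<phi>_def by (auto intro!: derivative_eq_intros)
    moreover have "d \<bullet> gradient f (x + t *\<^sub>R d) - gradient f x \<bullet> d \<le> L * t * (norm d)\<^sup>2"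
    proof -
      have "d \<bullet> (gradient f (x + t *\<^sub>R d) - gradient f x)
          \<le> norm d * norm (gradient f (x + t *\<^sub>R d) - gradient f x)"
        by (rule norm_cauchy_schwarz)
      also have "\<dots> \<le> norm d * (L * norm (t *\<^sub>R d))"
        using lipschitz_onD[OF lip, of "x + t *\<^sub>R d" x]
        by (intro mult_left_mono) (auto simp: dist_norm)
      finally show ?thesis
        using t by (simp add: inner_diff_right inner_commute power2_eq_square algebra_simps)
    qed
    ultimately show "\<exists>y. DERIV \<phi> t :> y \<and> y \<le> 0" by fastforce
  qed simp
  then show ?thesis by (simp add: \<phi>_def algebra_simps)
qed

text \<open>
  As \<open>x\<close> itself is sparse, \<open>x'\<close> is no farther than \<open>x\<close> from the end of the gradient step.
  Squared, this bounds the slope of \<open>f\<close> along \<open>x' - x\<close> from above by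
  \<open>- (norm (x' - x))^2 / (2 lam)\<close>, which outweighs the quadratic term when \<open>lam < 1 / L\<close>.
\<close>

lemma PG_map_sufficient_decrease:
  assumes f: "\<forall>x. f differentiable (at x)" and lip: "L-lipschitz_on UNIV (gradient f)"
    and lam: "lam > 0" and x: "x \<in> sparse_set s" and x': "x' \<in> PG_map s lam f x"
  shows "f x' \<le> f x - (inverse lam - L) / 2 * (norm (x' - x))\<^sup>2"
proof -
  define d where "d = x' - x"
  have "norm (x - lam *\<^sub>R gradient f x - x') \<le> norm (x - lam *\<^sub>R gradient f x - x)"
    using x x' by (auto simp: PG_map_def proj_set_def dist_norm)
  moreover have "x - lam *\<^sub>R gradient f x - x' = - (d + lam *\<^sub>R gradient f x)"
    by (simp add: d_def)
  ultimately have "norm (d + lam *\<^sub>R gradient f x) \<le> norm (lam *\<^sub>R gradient f x)"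
    by (simp only: norm_minus_cancel) simp
  then have "(norm (d + lam *\<^sub>R gradient f x))\<^sup>2 \<le> (norm (lam *\<^sub>R gradient f x))\<^sup>2"
    by (simp add: power_mono)
  moreover have "(norm (d + lam *\<^sub>R gradient f x))\<^sup>2
      = (norm d)\<^sup>2 + 2 * lam * (gradient f x \<bullet> d) + (norm (lam *\<^sub>R gradient f x))\<^sup>2"
    unfolding power2_norm_eq_inner by (simp add: inner_add_left inner_add_right inner_commute)
  ultimately have "(norm d)\<^sup>2 + 2 * lam * (gradient f x \<bullet> d) \<le> 0" by simp
  then have "gradient f x \<bullet> d \<le> - inverse lam / 2 * (norm d)\<^sup>2"
    using lam by (simp add: field_simps)
  moreover have "f x' \<le> f x + gradient f x \<bullet> d + L / 2 * (norm d)\<^sup>2"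
    using lipschitz_gradient_descent[OF f lip, of x d] by (simp add: d_def)
  ultimately have "f x' \<le> f x - inverse lam / 2 * (norm d)\<^sup>2 + L / 2 * (norm d)\<^sup>2" by linarith
  also have "\<dots> = f x - (inverse lam - L) / 2 * (norm d)\<^sup>2" by (simp add: field_simps)
  finally show ?thesis by (simp add: d_def)
qed

lemma PG_map_closed_graph:
  fixes v :: "nat \<Rightarrow> real ^ 'n"
  assumes lip: "L-lipschitz_on UNIV (gradient f)"
    and "\<And>n. y n \<in> PG_map s lam f (x n)" "x \<longlonglongrightarrow> a" "y \<longlonglongrightarrow> b"
  shows "b \<in> PG_map s lam f a"
proof -
  have "continuous_on UNIV (gradient f)" using lip by (rule lipschitz_on_continuous_on)
  then have "(\<lambda>n. gradient f (x n)) \<longlonglongrightarrow> gradient f a"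
    using assms(3) by (auto intro: continuous_on_tendsto_compose)
  then have lim: "(\<lambda>n. x n - lam *\<^sub>R gradient f (x n)) \<longlonglongrightarrow> a - lam *\<^sub>R gradient f a"
    by (intro tendsto_intros assms(3))
  show ?thesis
    using proj_set_closed_graph[OF closed_sparse_set _ lim assms(4)] assms(2) by (simp add: PG_map_def)
qed

text \<open>
  The sufficient decrease telescopes: as the objective is bounded below, consecutive iterates
  approach each other.  The successors along a subsequence therefore have the same limit, and
  the closed graph makes this limit a fixed point.
\<close>

lemma PG_accumulation_point_fixed:
  fixes f :: "real ^ 'n \<Rightarrow> real"
  assumes f: "\<forall>x. f differentiable (at x)" and lip: "L-lipschitz_on UNIV (gradient f)"
    and bdd: "bdd_below (f ` sparse_set s)" and lam: "0 < lam" "lam < inverse L" and L: "L > 0"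
    and v: "\<forall>k. v (Suc k) \<in> PG_map s lam f (v k)"
    and acc: "seq_accumulation_point v wstar"
  shows "wstar \<in> PG_map s lam f wstar"
proof -
  define c where "c = (inverse lam - L) / 2"
  have c: "c > 0" using lam L by (simp add: c_def field_simps)
  (* v 0 need not be sparse, so the decrease is only available from index 1 on. *)
  have sp: "v (Suc k) \<in> sparse_set s" for k
    using v by (auto simp: PG_map_def proj_set_def)
  define a where "a k = f (v (Suc k))" for k
  have dec: "c * (norm (v (Suc (Suc k)) - v (Suc k)))\<^sup>2 \<le> a k - a (Suc k)" for k
    using PG_map_sufficient_decrease[OF f lip lam(1) sp, of "v (Suc (Suc k))" k] v
    by (simp add: a_def c_def)
  have "0 \<le> c * (norm (v (Suc (Suc k)) - v (Suc k)))\<^sup>2" for k using c by simp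
  then have "a (Suc k) \<le> a k" for k using dec[of k] by (metis diff_ge_0_iff_ge order_trans)
  then have "decseq a" by (rule decseq_SucI)
  obtain l where l: "\<And>x. x \<in> sparse_set s \<Longrightarrow> l \<le> f x"
    using bdd by (auto simp: bdd_below_def)
  have "\<forall>k. l \<le> a k" unfolding a_def by (intro allI l sp)
  then obtain b where b: "a \<longlonglongrightarrow> b" using decseq_convergent[OF \<open>decseq a\<close>] by blast
  have "(\<lambda>k. (a k - a (Suc k)) / c) \<longlonglongrightarrow> (b - b) / c"
    using c by (intro tendsto_divide tendsto_diff b LIMSEQ_Suc[OF b] tendsto_const) simp
  then have "(\<lambda>k. (a k - a (Suc k)) / c) \<longlonglongrightarrow> 0" by simp
  then have "(\<lambda>k. (norm (v (Suc (Suc k)) - v (Suc k)))\<^sup>2) \<longlonglongrightarrow> 0"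
    by (rule tendsto_sandwich[OF _ _ tendsto_const, rotated 2])
      (use dec c in \<open>simp_all add: pos_le_divide_eq mult.commute\<close>)
  then have "(\<lambda>k. sqrt ((norm (v (Suc (Suc k)) - v (Suc k)))\<^sup>2)) \<longlonglongrightarrow> sqrt 0"
    by (rule tendsto_real_sqrt)
  then have "(\<lambda>k. v (Suc (Suc k)) - v (Suc k)) \<longlonglongrightarrow> 0"
    by (simp add: tendsto_norm_zero_iff)
  then have diff: "(\<lambda>k. v (Suc k) - v k) \<longlonglongrightarrow> 0"
    by (rule LIMSEQ_imp_Suc)
  obtain r where r: "strict_mono r" "(\<lambda>k. v (r k)) \<longlonglongrightarrow> wstar"
    using acc by (auto simp: seq_accumulation_point_def o_def)
  have "(\<lambda>k. v (Suc (r k)) - v (r k)) \<longlonglongrightarrow> 0"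
    using LIMSEQ_subseq_LIMSEQ[OF diff r(1)] by (simp add: o_def)
  from tendsto_add[OF this r(2)] have lim: "(\<lambda>k. v (Suc (r k))) \<longlonglongrightarrow> wstar" by simp
  show ?thesis by (rule PG_map_closed_graph[OF lip _ r(2) lim]) (use v in blast)
qed

text \<open>
  A point of \<open>coord_subspace J\<close> that the projection after a gradient step leaves in place has
  not been moved by that step in the coordinates of \<open>J\<close>.
\<close>

lemma PG_fixed_point_stationary:
  assumes fixpt: "wstar \<in> PG_map s lam f wstar" and lam: "lam > 0" and J: "J \<in> index_sets s wstar"
  shows "subvec J (gradient f wstar) = 0"
proof -
  have w: "wstar \<in> coord_subspace J" using J by (simp add: index_sets_def)
  have "wstar = subvec J (wstar - lam *\<^sub>R gradient f wstar)"
    by (rule proj_sparse_eq_subvec[OF fixpt[unfolded PG_map_def] w J])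
  also have "\<dots> = wstar - lam *\<^sub>R subvec J (gradient f wstar)"
    using w by (simp add: linear_diff[OF linear_subvec] linear_scale[OF linear_subvec]
        subvec_eq_self_iff)
  finally have "wstar - lam *\<^sub>R subvec J (gradient f wstar) = wstar" by (rule sym)
  then show ?thesis using lam by simp
qed

lemma norm_gradient_step_diff_le:
  assumes lip: "L-lipschitz_on UNIV (gradient f)" and lam: "lam \<ge> 0"
  shows "norm ((x - lam *\<^sub>R gradient f x) - (y - lam *\<^sub>R gradient f y)) \<le> (1 + lam * L) * norm (x - y)"
proof -
  have "(x - lam *\<^sub>R gradient f x) - (y - lam *\<^sub>R gradient f y)
      = (x - y) - lam *\<^sub>R (gradient f x - gradient f y)"
    by (simp add: algebra_simps)
  also have "norm \<dots> \<le> norm (x - y) + lam * norm (gradient f x - gradient f y)"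
    using norm_triangle_ineq4[of "x - y" "lam *\<^sub>R (gradient f x - gradient f y)"] lam by simp
  also have "\<dots> \<le> norm (x - y) + lam * (L * norm (x - y))"
    using lipschitz_onD[OF lip, of x y] lam by (intro add_left_mono mult_left_mono) (auto simp: dist_norm)
  finally show ?thesis by (simp add: algebra_simps)
qed

text \<open>
  Both \<open>x'\<close> and the fixed point are the images of gradient steps under the same linear
  projection \<open>subvec J\<close>, which is nonexpansive.
\<close>

lemma PG_map_lipschitz_at_fixed_point:
  assumes lip: "L-lipschitz_on UNIV (gradient f)" and lam: "lam \<ge> 0"
    and fixpt: "wstar \<in> PG_map s lam f wstar" and x': "x' \<in> PG_map s lam f x"
    and J: "J \<in> index_sets s wstar" "x' \<in> coord_subspace J"
  shows "norm (x' - wstar) \<le> (1 + lam * L) * norm (x - wstar)"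
proof -
  have w: "wstar \<in> coord_subspace J" using J by (simp add: index_sets_def)
  have "wstar = subvec J (wstar - lam *\<^sub>R gradient f wstar)"
    by (rule proj_sparse_eq_subvec[OF fixpt[unfolded PG_map_def] w J(1)])
  moreover have "x' = subvec J (x - lam *\<^sub>R gradient f x)"
    by (rule proj_sparse_eq_subvec[OF x'[unfolded PG_map_def] J(2,1)])
  ultimately have "x' - wstar
      = subvec J (x - lam *\<^sub>R gradient f x) - subvec J (wstar - lam *\<^sub>R gradient f wstar)"
    by (rule arg_cong2[where f = minus, rotated])
  also have "\<dots> = subvec J ((x - lam *\<^sub>R gradient f x) - (wstar - lam *\<^sub>R gradient f wstar))"
    by (rule linear_diff[OF linear_subvec, symmetric])
  finally have "norm (x' - wstar)
      \<le> norm ((x - lam *\<^sub>R gradient f x) - (wstar - lam *\<^sub>R gradient f wstar))"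
    using norm_subvec_le by (simp only:)
  also have "\<dots> \<le> (1 + lam * L) * norm (x - wstar)"
    by (rule norm_gradient_step_diff_le[OF lip lam])
  finally show ?thesis .
qed

text \<open>
  At a fixed point where the map is single-valued, nearby values are near the fixed point, and so
  keep all its nonzero coordinates.
\<close>

lemma PG_map_near_singleton:
  fixes wstar :: "real ^ 'n"
  assumes lip: "L-lipschitz_on UNIV (gradient f)" and lam: "lam \<ge> 0" and L: "L \<ge> 0"
    and fixpt: "wstar \<in> PG_map s lam f wstar" and sing: "is_singleton (PG_map s lam f wstar)"
    and s: "s \<le> CARD('n)"
  shows "\<exists>r>0. \<forall>x x'. dist x wstar < r \<longrightarrow> x' \<in> PG_map s lam f x \<longrightarrow>
           (\<exists>J\<in>index_sets s wstar. x' \<in> coord_subspace J)"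
proof -
  obtain e where e: "e > 0" "\<forall>x. dist x wstar < e \<longrightarrow> (\<forall>i. wstar $ i \<noteq> 0 \<longrightarrow> x $ i \<noteq> 0)"
    using nearby_support_superset by blast
  have "proj_set (sparse_set s) (wstar - lam *\<^sub>R gradient f wstar) = {wstar}"
    using fixpt sing by (auto simp: is_singleton_def PG_map_def)
  from proj_set_upper_semicontinuous[OF closed_sparse_set this e(1)]
  obtain d where d: "d > 0" "\<And>z. dist z (wstar - lam *\<^sub>R gradient f wstar) < d \<Longrightarrow>
      proj_set (sparse_set s) z \<subseteq> ball wstar e" by blast
  have D: "1 + lam * L > 0" using lam L by (simp add: add_pos_nonneg)
  show ?thesis
  proof (intro exI conjI allI impI)
    show "d / (1 + lam * L) > 0" using d D by simp
    fix x x' assume x: "dist x wstar < d / (1 + lam * L)" and x': "x' \<in> PG_map s lam f x"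
    have "dist (x - lam *\<^sub>R gradient f x) (wstar - lam *\<^sub>R gradient f wstar)
        \<le> (1 + lam * L) * dist x wstar"
      using norm_gradient_step_diff_le[OF lip lam] by (simp add: dist_norm)
    also have "\<dots> < d" using x D by (simp add: field_simps)
    finally have "x' \<in> ball wstar e" using d(2) x' unfolding PG_map_def by blast
    then have supp: "\<forall>i. wstar $ i \<noteq> 0 \<longrightarrow> x' $ i \<noteq> 0" using e(2) by (simp add: dist_commute)
    have "x' \<in> sparse_set s" using x' by (simp add: PG_map_def proj_set_def)
    then obtain J where "J \<in> index_sets s x'" using sparse_index_sets_nonempty s by blast
    then show "\<exists>J\<in>index_sets s wstar. x' \<in> coord_subspace J"
      using index_sets_antimono[OF _ supp] by (auto simp: index_sets_def)
  qed
qed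


section \<open>The accelerated iteration\<close>

text \<open>
  The bound \<open>C \<rho> \<le> 1 / 2\<close> turns the quadratic estimate into a halving of the error, which
  keeps the sequence in the ball where the estimate applies.  The invariant \<open>P\<close> carries what
  the step needs besides closeness, namely sparsity.
\<close>

lemma Q_quadratic_rate_from_contraction:
  fixes w :: "nat \<Rightarrow> 'a::real_normed_vector"
  assumes C: "C > 0" and rho: "C * \<rho> \<le> 1 / 2" and start: "norm (w K - x) < \<rho>"
    and step: "\<And>k. k \<ge> K \<Longrightarrow> P (w k) \<Longrightarrow> norm (w k - x) < \<rho> \<Longrightarrow>
        P (w (Suc k)) \<and> norm (w (Suc k) - x) \<le> C * (norm (w k - x))\<^sup>2"
    and P: "P (w K)"
  shows "w \<longlonglongrightarrow> x \<and> Q_quadratic_rate w x"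
proof -
  have inv: "P (w (K + n)) \<and> norm (w (K + n) - x) < \<rho> \<and> norm (w (K + n) - x) \<le> \<rho> * (1 / 2) ^ n"
    for n
  proof (induction n)
    case 0
    then show ?case using start P by simp
  next
    case (Suc n)
    let ?e = "norm (w (K + n) - x)" and ?e' = "norm (w (Suc (K + n)) - x)"
    have st: "P (w (Suc (K + n)))" "?e' \<le> C * ?e\<^sup>2"
      using step[of "K + n"] Suc by auto
    have "C * ?e \<le> C * \<rho>" using Suc C by (intro mult_left_mono) auto
    then have "C * ?e\<^sup>2 \<le> 1 / 2 * ?e"
      using rho by (simp only: power2_eq_square mult.assoc[symmetric]) (intro mult_right_mono, auto)
    with st(2) have "?e' \<le> ?e / 2" by simp
    moreover have "?e / 2 < \<rho>" using Suc norm_ge_zero[of "w (K + n) - x"] by linarith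
    ultimately show ?case using st(1) Suc by simp
  qed
  have quad: "norm (w (Suc k) - x) \<le> C * (norm (w k - x))\<^sup>2" if "k \<ge> K" for k
    using step[OF that] inv[of "k - K"] that by simp
  have "(\<lambda>n. \<rho> * (1 / 2) ^ n) \<longlonglongrightarrow> \<rho> * 0"
    by (intro tendsto_intros LIMSEQ_power_zero) auto
  then have null: "(\<lambda>n. \<rho> * (1 / 2) ^ n) \<longlonglongrightarrow> 0" by simp
  have "norm (w (n + K) - x) \<le> \<rho> * (1 / 2) ^ n" for n
    using inv[of n] unfolding add.commute[of n K] by blast
  then have "(\<lambda>n. w (n + K) - x) \<longlonglongrightarrow> 0"
    by (intro Lim_null_comparison[OF always_eventually null]) blast
  then have "(\<lambda>n. w (n + K)) \<longlonglongrightarrow> x"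
    by (rule LIM_zero_cancel)
  then have "w \<longlonglongrightarrow> x" by (rule LIMSEQ_offset)
  moreover have "Q_quadratic_rate w x"
    unfolding Q_quadratic_rate_def using C quad by (auto simp: eventually_sequentially)
  ultimately show ?thesis ..
qed

text \<open>
  The first Newton step squares the error and the later ones do not increase it, so
  the bound does not depend on the number of steps.
\<close>

lemma newton_steps_quadratic:
  fixes y :: "nat \<Rightarrow> real ^ 'n"
  assumes newton: "\<And>z z'. z \<in> coord_subspace J \<Longrightarrow> dist z wstar < \<rho> \<Longrightarrow> newton_step f J z z' \<Longrightarrow>
        z' \<in> coord_subspace J \<and> norm (z' - wstar) \<le> C * (norm (z - wstar))\<^sup>2"
    and C: "C \<ge> 0" and rho: "C * \<rho> \<le> 1"
    and y0: "y 0 \<in> coord_subspace J" "dist (y 0) wstar < \<rho>"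
    and steps: "\<forall>j<t. newton_step f J (y j) (y (Suc j))" and t: "t \<ge> 1"
  shows "norm (y t - wstar) \<le> C * (norm (y 0 - wstar))\<^sup>2" and "dist (y t) wstar < \<rho>"
proof -
  have contr: "C * (norm (z - wstar))\<^sup>2 \<le> norm (z - wstar)" if "dist z wstar < \<rho>" for z
  proof -
    have "C * norm (z - wstar) \<le> 1"
      using mult_left_mono[of "norm (z - wstar)" \<rho> C] C rho that by (simp add: dist_norm)
    from mult_right_mono[OF this, of "norm (z - wstar)"] show ?thesis
      by (simp add: power2_eq_square mult.assoc)
  qed
  have "y (Suc j) \<in> coord_subspace J \<and> norm (y (Suc j) - wstar) \<le> C * (norm (y 0 - wstar))\<^sup>2 \<and>
      dist (y (Suc j)) wstar < \<rho>" if "Suc j \<le> t" for j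
    using that
  proof (induction j)
    case 0
    then show ?case using newton[OF y0] steps contr[OF y0(2)] y0(2) by (force simp: dist_norm)
  next
    case (Suc j)
    then have IH: "y (Suc j) \<in> coord_subspace J" "norm (y (Suc j) - wstar) \<le> C * (norm (y 0 - wstar))\<^sup>2"
      "dist (y (Suc j)) wstar < \<rho>" by auto
    have "newton_step f J (y (Suc j)) (y (Suc (Suc j)))" using steps Suc by auto
    from newton[OF IH(1,3) this] contr[OF IH(3)] IH(2,3) show ?case by (auto simp: dist_norm)
  qed
  from this[of "t - 1"] t
  show "norm (y t - wstar) \<le> C * (norm (y 0 - wstar))\<^sup>2" and "dist (y t) wstar < \<rho>" by auto
qed

theorem theorem3p3:
  fixes f :: "real ^ 'n \<Rightarrow> real" and L lam :: real and s N :: nat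
    and v :: "nat \<Rightarrow> real ^ 'n" and wstar :: "real ^ 'n" and U :: "(real ^ 'n) set"
  assumes "convex_on UNIV f"
    and "\<forall>x. f differentiable (at x)"
    and "L > 0" and "L-lipschitz_on UNIV (gradient f)"
    and "bdd_below (f ` sparse_set s)"
    and "0 < lam" and "lam < inverse L"
    (* v: the projected gradient iterates *)
    and "\<forall>k. v (Suc k) \<in> PG_map s lam f (v k)"
    and "wstar \<in> sparse_set s"
    and "v \<longlonglongrightarrow> wstar \<or>
         (seq_accumulation_point v wstar \<and> is_singleton (PG_map s lam f wstar))"
    and "\<forall>k\<ge>N. v k \<in> (\<Union>J \<in> index_sets s wstar. coord_subspace J)"
    and "wstar \<in> interior U"
    and "\<forall>x\<in>U. gradient f differentiable (at x)"
    and "\<forall>J \<in> index_sets s wstar.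
           \<exists>M. M-lipschitz_on (subvec J ` (coord_subspace J \<inter> U)) (hessian (sub_fun f J))"
    and "\<forall>J \<in> index_sets s wstar. pos_def_on J (hessian (sub_fun f J) (subvec J wstar))"
  (* V: the neighborhood U, shrunk if necessary;
     w: the iterates when t Newton steps are inserted from iteration K on;
     where the projected gradient map is multivalued at wstar, the property defining N is also
     required of w, which could otherwise leave wstar along another value of the map *)
  shows "\<exists>V. open V \<and> wstar \<in> V \<and> V \<subseteq> U \<and>
    (\<forall>t K w. t \<ge> 1 \<longrightarrow> K \<ge> N \<longrightarrow> (\<forall>k\<le>K. w k = v k) \<longrightarrow>
       proj_set (sparse_set s) (w K) \<subseteq> V \<longrightarrow>
       (\<forall>k\<ge>K. newton_PG_step s lam f t (w k) (w (Suc k))) \<longrightarrow>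
       (is_singleton (PG_map s lam f wstar) \<or>
        (\<forall>k\<ge>N. w k \<in> (\<Union>J \<in> index_sets s wstar. coord_subspace J))) \<longrightarrow>
       w \<longlonglongrightarrow> wstar \<and> Q_quadratic_rate w wstar)"
proof -
  note f = assms(2) and L = assms(3) and lip = assms(4) and lam = assms(6,7) and v = assms(8)
  let ?F = "index_sets s wstar"
  have "wstar \<in> PG_map s lam f wstar" if "v \<longlonglongrightarrow> wstar"
    using PG_map_closed_graph[OF lip _ that LIMSEQ_Suc[OF that]] v by blast
  then have fixpt: "wstar \<in> PG_map s lam f wstar"
    using PG_accumulation_point_fixed[OF f lip assms(5) lam L v] assms(10) by blast
  have finF: "finite ?F" by simp
  have neF: "?F \<noteq> {}" using assms(11) by blast
  then have s: "s \<le> CARD('n)"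
    by (auto simp: index_sets_def intro!: card_mono)

  define newton_bound where "newton_bound J C r \<longleftrightarrow> C > 0 \<and> r > 0 \<and>
      (\<forall>y y'. y \<in> coord_subspace J \<longrightarrow> dist y wstar < r \<longrightarrow> newton_step f J y y' \<longrightarrow>
        y' \<in> coord_subspace J \<and> norm (y' - wstar) \<le> C * (norm (y - wstar))\<^sup>2)" for J C r
  have "\<forall>J\<in>?F. \<exists>C r. newton_bound J C r"
  proof
    fix J assume J: "J \<in> ?F"
    obtain M where M: "M-lipschitz_on (subvec J ` (coord_subspace J \<inter> U)) (hessian (sub_fun f J))"
      using assms(14) J by blast
    have pd: "pos_def_on J (hessian (sub_fun f J) (subvec J wstar))" using assms(15) J by blast
    have "wstar \<in> coord_subspace J" using J by (simp add: index_sets_def)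
    from newton_step_locally_quadratic[OF f assms(12,13) this
        PG_fixed_point_stationary[OF fixpt lam(1) J] M pd]
    show "\<exists>C r. newton_bound J C r" unfolding newton_bound_def by blast
  qed
  from bchoice[OF this] obtain CJ where "\<forall>J\<in>?F. \<exists>r. newton_bound J (CJ J) r" ..
  from bchoice[OF this] obtain rJ where CrJ: "\<forall>J\<in>?F. newton_bound J (CJ J) (rJ J)" ..
  define C where "C = Max (CJ ` ?F)"
  define r where "r = Min (rJ ` ?F)"
  have C: "C > 0" and r: "r > 0"
    using CrJ finF neF by (auto simp: newton_bound_def C_def r_def Max_gr_iff)
  have newton: "z' \<in> coord_subspace J \<and> norm (z' - wstar) \<le> C * (norm (z - wstar))\<^sup>2"
    if "J \<in> ?F" "z \<in> coord_subspace J" "dist z wstar < r" "newton_step f J z z'" for J z z'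
  proof -
    have "r \<le> rJ J" "CJ J \<le> C" using that(1) finF by (auto simp: r_def C_def)
    then have "z' \<in> coord_subspace J" "norm (z' - wstar) \<le> CJ J * (norm (z - wstar))\<^sup>2"
      using CrJ that unfolding newton_bound_def by (meson order_less_le_trans)+
    moreover have "CJ J * (norm (z - wstar))\<^sup>2 \<le> C * (norm (z - wstar))\<^sup>2"
      using \<open>CJ J \<le> C\<close> by (intro mult_right_mono) auto
    ultimately show ?thesis by auto
  qed

  obtain r1 where r1: "r1 > 0" "\<forall>x. dist x wstar < r1 \<longrightarrow> (\<forall>i. wstar $ i \<noteq> 0 \<longrightarrow> x $ i \<noteq> 0)"
    using nearby_support_superset by blast
  obtain r2 where r2: "r2 > 0" "is_singleton (PG_map s lam f wstar) \<Longrightarrow>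
      \<forall>x x'. dist x wstar < r2 \<longrightarrow> x' \<in> PG_map s lam f x \<longrightarrow> (\<exists>J\<in>?F. x' \<in> coord_subspace J)"
  proof (cases "is_singleton (PG_map s lam f wstar)")
    case True
    then show ?thesis
      using PG_map_near_singleton[OF lip _ _ fixpt True s] lam L that by force
  qed (use that[of 1] in auto)
  obtain r3 where r3: "r3 > 0" "ball wstar r3 \<subseteq> U"
    using assms(12) by (auto simp: mem_interior)
  define D where "D = 1 + lam * L"
  have D: "D \<ge> 1" using lam L by (simp add: D_def)
  (* the last term makes one outer step at least halve the error *)
  define \<rho> where "\<rho> = min (min (min r r1) (min r2 r3)) (1 / (2 * D * C))"
  have \<rho>: "\<rho> > 0" "\<rho> \<le> r" "\<rho> \<le> r1" "\<rho> \<le> r2" "\<rho> \<le> r3" "\<rho> \<le> 1 / (2 * D * C)"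
    using r r1 r2 r3 C D by (auto simp: \<rho>_def)
  have half: "D * C * \<rho> \<le> 1 / 2" using \<rho>(6) C D by (simp add: field_simps)
  have "C * \<rho> \<le> D * (C * \<rho>)" using mult_right_mono[OF D, of "C * \<rho>"] C \<rho>(1) by simp
  then have C\<rho>: "C * \<rho> \<le> 1" using half by (simp add: mult.assoc)

  have outer: "x' \<in> sparse_set s \<and> norm (x' - wstar) \<le> D * C * (norm (x - wstar))\<^sup>2"
    if x: "x \<in> sparse_set s" "norm (x - wstar) < \<rho>" and t: "t \<ge> 1"
      and st: "newton_PG_step s lam f t x x'"
      and alt: "is_singleton (PG_map s lam f wstar) \<or> (\<exists>J\<in>?F. x' \<in> coord_subspace J)" for t x x'
  proof -
    obtain y J where y: "y 0 \<in> proj_set (sparse_set s) x" and J: "J \<in> index_sets s (y 0)"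
      and steps: "\<forall>j<t. newton_step f J (y j) (y (Suc j))" and x': "x' \<in> PG_map s lam f (y t)"
      using st by (auto simp: newton_PG_step_def)
    have y0: "y 0 = x" using y x by (simp add: proj_set_self)
    have dx: "dist x wstar < \<rho>" using x by (simp add: dist_norm)
    (* near wstar, an index set admissible for the iterate is admissible for wstar *)
    have JF: "J \<in> ?F"
      using index_sets_antimono[of J s x wstar] J r1(2) dx \<rho>(3) by (auto simp: y0)
    have "y 0 \<in> coord_subspace J" using J by (simp add: index_sets_def)
    moreover have "dist (y 0) wstar < \<rho>" using dx y0 by simp
    moreover have "z' \<in> coord_subspace J \<and> norm (z' - wstar) \<le> C * (norm (z - wstar))\<^sup>2"
      if "z \<in> coord_subspace J" "dist z wstar < \<rho>" "newton_step f J z z'" for z z'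
      using newton[OF JF that(1) _ that(3)] that(2) \<rho>(2) by linarith
    ultimately have yt: "norm (y t - wstar) \<le> C * (norm (x - wstar))\<^sup>2" "dist (y t) wstar < \<rho>"
      using newton_steps_quadratic[OF _ less_imp_le[OF C] C\<rho> _ _ steps t] y0 by blast+
    obtain J' where "J' \<in> ?F" "x' \<in> coord_subspace J'"
      using alt r2(2) less_le_trans[OF yt(2) \<rho>(4)] x' by blast
    then have "norm (x' - wstar) \<le> D * norm (y t - wstar)"
      using PG_map_lipschitz_at_fixed_point[OF lip _ fixpt x'] lam by (simp add: D_def)
    also have "\<dots> \<le> D * (C * (norm (x - wstar))\<^sup>2)"
      using yt(1) D by (intro mult_left_mono) auto
    finally show ?thesis using x' by (simp add: PG_map_def proj_set_def mult.assoc)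
  qed

  show ?thesis
  proof (intro exI[of _ "ball wstar \<rho>"] conjI allI impI)
    show "open (ball wstar \<rho>)" "wstar \<in> ball wstar \<rho>" using \<rho> by auto
    show "ball wstar \<rho> \<subseteq> U" using r3(2) \<rho>(5) by (meson order_trans subset_ball)
  next
    fix t K :: nat and w :: "nat \<Rightarrow> real ^ 'n"
    assume t: "1 \<le> t" and K: "N \<le> K" and wv: "\<forall>k\<le>K. w k = v k"
      and V: "proj_set (sparse_set s) (w K) \<subseteq> ball wstar \<rho>"
      and st: "\<forall>k\<ge>K. newton_PG_step s lam f t (w k) (w (Suc k))"
      and alt: "is_singleton (PG_map s lam f wstar) \<or> (\<forall>k\<ge>N. w k \<in> (\<Union>J\<in>?F. coord_subspace J))"
    have wK: "w K \<in> sparse_set s"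
      using assms(11) K wv index_sets_coord_subset_sparse by fastforce
    then have start: "norm (w K - wstar) < \<rho>"
      using V by (simp add: proj_set_self dist_norm norm_minus_commute)
    have "w \<longlonglongrightarrow> wstar \<and> Q_quadratic_rate w wstar"
    proof (rule Q_quadratic_rate_from_contraction[where C = "D * C" and P = "\<lambda>x. x \<in> sparse_set s"])
      fix k assume "k \<ge> K" "w k \<in> sparse_set s" "norm (w k - wstar) < \<rho>"
      then show "w (Suc k) \<in> sparse_set s \<and> norm (w (Suc k) - wstar) \<le> D * C * (norm (w k - wstar))\<^sup>2"
        using st alt K t by (intro outer[where t = t]) auto
    qed (use C D half start wK in auto)
    then show "w \<longlonglongrightarrow> wstar" "Q_quadratic_rate w wstar" by auto
  qed
qed

end
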